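(* Let $K>0$ and let $f:[0,\infty)\to[0,\infty)$ be continuous with $f(0)=0$, $f(x)>0$ for all $x>0$, with only two fixed points $0$ and $K$, and with $f(x)>x$ for all $0<x<K$ and $f(x)<x$ for all $x>K$. Assume that there are $c>0$ and $\lambda>0$ such that $f$ is (strictly) increasing on $[0,c]$ and $f(x)\ge\lambda$ for all $x\in(c,\infty)$. Let $(\gamma_n)_{n\ge1}$ be a real sequence with $\lim_{n\to\infty}\gamma_n=0$, put $\tilde\gamma=\sup_{n\in\mathbb N}|\gamma_n^-|$ with $\gamma_n^-=\min\{\gamma_n,0\}$, and suppose the set $\{x>0:f(x)-x>\tilde\gamma\}$ is non-empty. Let $$b=b(\tilde\gamma)=\inf\{x>0:f(x)-x>\tilde\gamma\}$$ and assume $\tilde\gamma+b(\tilde\gamma)<\lambda$. Then any solution of $$x_{n+1}=\max\{f(x_n)+\gamma_{n+1},0\},\quad n=0,1,\dots,$$ with initial value $x_0\in(b(\tilde\gamma),\infty)$ satisfies $x_n>b(\tilde\gamma)$ for all $n$.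
   Context: $\mathbb N=\{1,2,\dots\}$. *)

theory Defs
  imports Complex_Main
begin

(* gamma 0 is junk: the perturbation sequence is indexed by n >= 1. *)
definition gamma_tilde :: "(nat \<Rightarrow> real) \<Rightarrow> real" where
  "gamma_tilde \<gamma> = (SUP n\<in>{1..}. \<bar>min (\<gamma> n) 0\<bar>)"

definition gain_set :: "(real \<Rightarrow> real) \<Rightarrow> real \<Rightarrow> real set" where
  "gain_set f g = {x. x > 0 \<and> f x - x > g}"

definition b_threshold :: "(real \<Rightarrow> real) \<Rightarrow> real \<Rightarrow> real" where
  "b_threshold f g = Inf (gain_set f g)"

definition is_solution :: "(real \<Rightarrow> real) \<Rightarrow> (nat \<Rightarrow> real) \<Rightarrow> (nat \<Rightarrow> real) \<Rightarrow> bool" where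
  "is_solution f \<gamma> x \<longleftrightarrow> (\<forall>n. x (Suc n) = max (f (x n) + \<gamma> (Suc n)) 0)"

end

theory Submission
  imports Defs
begin

text \<open>Write g for \<open>gamma_tilde \<gamma>\<close> and b for
  \<open>b_threshold f g\<close>. The interval above b is invariant because f maps it above b + g,
  while a perturbation lowers the value by at most g (\<open>gamma_tilde_lower_bound\<close>). For
  points up to c, monotonicity reduces the claim to b itself, where continuity gives f b >= b + g
  (\<open>f_b_threshold_ge\<close>); beyond c, the lower bound l already exceeds b + g.\<close>

lemma gamma_tilde_lower_bound:
  assumes "\<gamma> \<longlonglongrightarrow> (0::real)" and "n \<ge> 1"
  shows "- gamma_tilde \<gamma> \<le> \<gamma> n"
proof -
  \<comment> \<open>A real \<open>SUP\<close> dominates its terms only if they are bounded above;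
    convergence supplies this bound.\<close>
  have "Bseq \<gamma>"
    using assms(1) by (blast intro: convergent_imp_Bseq convergentI)
  then obtain B where B: "\<And>k. \<bar>\<gamma> k\<bar> \<le> B"
    unfolding Bseq_def by auto
  have "\<bar>min (\<gamma> k) 0\<bar> \<le> B" for k
    using B[of k] by linarith
  then have "bdd_above ((\<lambda>k. \<bar>min (\<gamma> k) 0\<bar>) ` {1..})"
    by (intro bdd_aboveI[of _ B]) auto
  then have "\<bar>min (\<gamma> n) 0\<bar> \<le> gamma_tilde \<gamma>"
    unfolding gamma_tilde_def using assms(2) by (intro cSUP_upper) auto
  then show ?thesis
    by linarith
qed

lemma b_threshold_nonneg:
  assumes "gain_set f g \<noteq> {}"
  shows "0 \<le> b_threshold f g"
  unfolding b_threshold_def using assms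
  by (intro cInf_greatest) (auto simp: gain_set_def)

text \<open>The infimum b is a limit of points where f y - y > g, or one of them, so continuity
  preserves the inequality in weak form. Strictness can fail: if g = 0, b may be 0 with f 0 = 0.
  Continuity is taken within \<open>{0..}\<close> because b may be this endpoint.\<close>

lemma f_b_threshold_ge:
  assumes cont: "continuous_on {0..} f" and ne: "gain_set f g \<noteq> {}"
  shows "b_threshold f g + g \<le> f (b_threshold f g)"
proof (rule ccontr)
  define b where "b = b_threshold f g"
  assume "\<not> ?thesis"
  then have less: "f b - b < g"
    unfolding b_def by simp
  have b0: "0 \<le> b"
    unfolding b_def by (rule b_threshold_nonneg[OF ne])
  have "continuous_on {0..} (\<lambda>y. f y - y)"
    by (intro continuous_intros cont)
  then have "((\<lambda>y. f y - y) \<longlongrightarrow> f b - b) (at b within {0..})"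
    using b0 by (simp add: continuous_on_def)
  then have "eventually (\<lambda>y. f y - y < g) (at b within {0..})"
    using less by (rule order_tendstoD)
  then obtain d where "d > 0"
    and d: "\<And>y. y \<in> {0..} \<Longrightarrow> y \<noteq> b \<Longrightarrow> dist y b < d \<Longrightarrow> f y - y < g"
    unfolding eventually_at by blast
  have bdd: "bdd_below (gain_set f g)"
    by (rule bdd_belowI[of _ 0]) (auto simp: gain_set_def)
  obtain y where y: "y \<in> gain_set f g" "y < b + d"
    using cInf_lessD[OF ne, of "b + d"] \<open>d > 0\<close>
    unfolding b_def b_threshold_def by auto
  have "b \<le> y"
    unfolding b_def b_threshold_def by (rule cInf_lower[OF y(1) bdd])
  \<comment> \<open>If y = b, membership in \<open>gain_set f g\<close> contradicts
    \<open>less\<close>; otherwise y lies in the punctured neighbourhood where f y - y < g.\<close>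
  then show False
    using d[of y] y less by (cases "y = b") (auto simp: gain_set_def dist_real_def)
qed

theorem proposition3p13:
  fixes f :: "real \<Rightarrow> real" and K c l :: real and \<gamma> x :: "nat \<Rightarrow> real"
  assumes "K > 0"
    and "f ` {0..} \<subseteq> {0..}"
    and "continuous_on {0..} f"
    and "f 0 = 0"
    and "\<forall>y>0. f y > 0"
    and "{y. y \<ge> 0 \<and> f y = y} = {0, K}"
    and "\<forall>y. 0 < y \<and> y < K \<longrightarrow> f y > y"
    and "\<forall>y>K. f y < y"
    and "c > 0" and "l > 0"
    and "strict_mono_on {0..c} f"
    and "\<forall>y\<in>{c<..}. f y \<ge> l"
    and "\<gamma> \<longlonglongrightarrow> 0"
    and "gain_set f (gamma_tilde \<gamma>) \<noteq> {}"
    and "gamma_tilde \<gamma> + b_threshold f (gamma_tilde \<gamma>) < l"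
    and "is_solution f \<gamma> x"
    and "x 0 \<in> {b_threshold f (gamma_tilde \<gamma>)<..}"
  shows "\<forall>n. x n > b_threshold f (gamma_tilde \<gamma>)"
proof
  define g where "g = gamma_tilde \<gamma>"
  define b where "b = b_threshold f g"
  have b0: "0 \<le> b" and fb: "b + g \<le> f b"
    unfolding b_def g_def using b_threshold_nonneg f_b_threshold_ge assms(3,14) by blast+
  have f_gt: "b + g < f y" if "b < y" for y
  proof (cases "y \<le> c")
    case True
    \<comment> \<open>Here b < y <= c, so b also lies in \<open>{0..c}\<close>. The strict increase
      makes up for the weak inequality \<open>fb\<close>.\<close>
    then have "f b < f y"
      using that b0 by (intro strict_mono_onD[OF assms(11)]) auto
    then show ?thesis
      using fb by linarith
  next
    case False
    then have "l \<le> f y"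
      using assms(12) by simp
    then show ?thesis
      using assms(15) unfolding b_def g_def by linarith
  qed
  have "b < x n" for n
  proof (induction n)
    case 0
    then show ?case
      using assms(17) unfolding b_def g_def by simp
  next
    case (Suc n)
    have "- g \<le> \<gamma> (Suc n)"
      unfolding g_def by (rule gamma_tilde_lower_bound[OF assms(13)]) simp
    then have "b < f (x n) + \<gamma> (Suc n)"
      using f_gt[OF Suc] by linarith
    \<comment> \<open>Truncation at 0 can only raise the value, so the bound passes to the
      maximum.\<close>
    then show ?case
      using assms(16) unfolding is_solution_def by simp
  qed
  then show "b_threshold f (gamma_tilde \<gamma>) < x n" for n
    unfolding b_def g_def .
qed

end
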